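(* If $G$ and $G'$ are non-isomorphic graphs that have the same order $n$, then $\mathrm{D}_0(G,G')\le (n+5)/2$.
   Context: Graphs are finite, undirected and loopless; the order is the number of vertices. A graph is regarded as a structure with a single irreflexive symmetric binary predicate $E$ (adjacency). First order formulas use $E$, $=$ and the connectives $\neg,\wedge,\vee$. A closed formula $\Phi$ distinguishes $G$ from $G'$ if it is true on $G$ and false on $G'$. The set $\mathrm{Nest}(\Phi)$ of sequences of nested quantifiers is defined inductively: $\mathrm{Nest}(\Phi)=\{\epsilon\}$ (the empty word) for atomic $\Phi$; $\mathrm{Nest}(\neg\Phi)$ is obtained from $\mathrm{Nest}(\Phi)$ by exchanging $\exists$ and $\forall$ in all words; $\mathrm{Nest}(\Phi\wedge\Psi)=\mathrm{Nest}(\Phi\vee\Psi)=\mathrm{Nest}(\Phi)\cup\mathrm{Nest}(\Psi)$; $\mathrm{Nest}(\exists x\Phi)$ and $\mathrm{Nest}(\forall x\Phi)$ are obtained by prepending $\exists$, respectively $\forall$, to every word of $\mathrm{Nest}(\Phi)$. The quantifier rank of $\Phi$ is the maximum length of a word in $\mathrm{Nest}(\Phi)$; the alternation number of $\Phi$ is the maximum, over words in $\mathrm{Nest}(\Phi)$, of the number of occurrences of $\exists\forall$ and $\forall\exists$ as consecutive letters. $\mathrm{D}_0(G,G')$ is the minimum quantifier rank of a formula with alternation number $0$ distinguishing $G$ from $G'$. *)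

theory Defs
  imports
    "Graph_Theory.Digraph_Isomorphism"
    "Graph_Theory.Pair_Digraph"
    "HOL-Library.Extended_Real"
begin

datatype fm =
    Eql nat nat
  | Adj nat nat
  | Neg fm
  | Conj fm fm
  | Disj fm fm
  | Exi nat fm
  | Uni nat fm

primrec free_vars :: "fm \<Rightarrow> nat set" where
  "free_vars (Eql x y) = {x, y}"
| "free_vars (Adj x y) = {x, y}"
| "free_vars (Neg \<phi>) = free_vars \<phi>"
| "free_vars (Conj \<phi> \<psi>) = free_vars \<phi> \<union> free_vars \<psi>"
| "free_vars (Disj \<phi> \<psi>) = free_vars \<phi> \<union> free_vars \<psi>"
| "free_vars (Exi x \<phi>) = free_vars \<phi> - {x}"
| "free_vars (Uni x \<phi>) = free_vars \<phi> - {x}"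

definition closed_fm :: "fm \<Rightarrow> bool" where
  "closed_fm \<phi> \<longleftrightarrow> free_vars \<phi> = {}"

text \<open>
  An undirected graph is a \<^locale>\<open>pair_graph\<close>: its arc set is the adjacency relation, which is
  irreflexive and symmetric. Quantifiers range over the vertex set only, whereas a valuation is an
  arbitrary function into the type.
\<close>

primrec sat :: "'a pair_pre_digraph \<Rightarrow> (nat \<Rightarrow> 'a) \<Rightarrow> fm \<Rightarrow> bool" where
  "sat G v (Eql x y) \<longleftrightarrow> v x = v y"
| "sat G v (Adj x y) \<longleftrightarrow> (v x, v y) \<in> parcs G"
| "sat G v (Neg \<phi>) \<longleftrightarrow> \<not> sat G v \<phi>"
| "sat G v (Conj \<phi> \<psi>) \<longleftrightarrow> sat G v \<phi> \<and> sat G v \<psi>"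
| "sat G v (Disj \<phi> \<psi>) \<longleftrightarrow> sat G v \<phi> \<or> sat G v \<psi>"
| "sat G v (Exi x \<phi>) \<longleftrightarrow> (\<exists>a\<in>pverts G. sat G (v(x := a)) \<phi>)"
| "sat G v (Uni x \<phi>) \<longleftrightarrow> (\<forall>a\<in>pverts G. sat G (v(x := a)) \<phi>)"

text \<open>
  Only used for closed formulas, whose truth value is the same under all valuations
  (lemma \<open>models_closed\<close> below).
\<close>

definition models :: "'a pair_pre_digraph \<Rightarrow> fm \<Rightarrow> bool" where
  "models G \<phi> \<longleftrightarrow> (\<forall>v. sat G v \<phi>)"

lemma sat_cong_free_vars:
  "(\<And>x. x \<in> free_vars \<phi> \<Longrightarrow> v x = w x) \<Longrightarrow> sat G v \<phi> \<longleftrightarrow> sat G w \<phi>"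
proof (induction \<phi> arbitrary: v w)
  case (Neg \<phi>)
  from Neg.IH[of v w] Neg.prems show ?case by simp
next
  case (Conj \<phi> \<psi>)
  from Conj.IH(1)[of v w] Conj.IH(2)[of v w] Conj.prems show ?case by simp
next
  case (Disj \<phi> \<psi>)
  from Disj.IH(1)[of v w] Disj.IH(2)[of v w] Disj.prems show ?case by simp
next
  case (Exi x \<phi>)
  have "sat G (v(x := a)) \<phi> \<longleftrightarrow> sat G (w(x := a)) \<phi>" for a
    by (rule Exi.IH) (use Exi.prems in auto)
  then show ?case by simp
next
  case (Uni x \<phi>)
  have "sat G (v(x := a)) \<phi> \<longleftrightarrow> sat G (w(x := a)) \<phi>" for a
    by (rule Uni.IH) (use Uni.prems in auto)
  then show ?case by simp
qed simp_all

lemma models_closed: "closed_fm \<phi> \<Longrightarrow> models G \<phi> \<longleftrightarrow> sat G v \<phi>"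
  unfolding models_def closed_fm_def using sat_cong_free_vars by blast

definition distinguishes :: "fm \<Rightarrow> 'a pair_pre_digraph \<Rightarrow> 'b pair_pre_digraph \<Rightarrow> bool" where
  "distinguishes \<phi> G G' \<longleftrightarrow> closed_fm \<phi> \<and> models G \<phi> \<and> \<not> models G' \<phi>"

datatype quant = QExi | QUni

primrec swap_quant :: "quant \<Rightarrow> quant" where
  "swap_quant QExi = QUni"
| "swap_quant QUni = QExi"

primrec Nest :: "fm \<Rightarrow> quant list set" where
  "Nest (Eql x y) = {[]}"
| "Nest (Adj x y) = {[]}"
| "Nest (Neg \<phi>) = map swap_quant ` Nest \<phi>"
| "Nest (Conj \<phi> \<psi>) = Nest \<phi> \<union> Nest \<psi>"
| "Nest (Disj \<phi> \<psi>) = Nest \<phi> \<union> Nest \<psi>"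
| "Nest (Exi x \<phi>) = (#) QExi ` Nest \<phi>"
| "Nest (Uni x \<phi>) = (#) QUni ` Nest \<phi>"

definition quantifier_rank :: "fm \<Rightarrow> nat" where
  "quantifier_rank \<phi> = Max (length ` Nest \<phi>)"

definition word_alternations :: "quant list \<Rightarrow> nat" where
  "word_alternations w =
     card {i. Suc i < length w \<and>
       (w ! i = QExi \<and> w ! Suc i = QUni \<or> w ! i = QUni \<and> w ! Suc i = QExi)}"

definition alternation_number :: "fm \<Rightarrow> nat" where
  "alternation_number \<phi> = Max (word_alternations ` Nest \<phi>)"

text \<open>
  The value is \<open>\<infinity>\<close> if there is no such formula, so a finite upper bound on it includes
  the existence of a distinguishing formula.
\<close>

definition D0 :: "'a pair_pre_digraph \<Rightarrow> 'b pair_pre_digraph \<Rightarrow> enat" where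
  "D0 G G' = (INF \<phi> \<in> {\<phi>. alternation_number \<phi> = 0 \<and> distinguishes \<phi> G G'}.
     enat (quantifier_rank \<phi>))"

end

theory Submission
  imports Defs "HOL-Library.Product_Lexorder"
begin

text \<open>
  Spoiler wins a game in which he always plays in the same graph. A list \<open>xs\<close> of \<open>s\<close> vertices
  partitions the other vertices by their adjacencies to \<open>xs\<close>. Among all lists, in either graph,
  with at least \<open>s + 1\<close> classes, choose one that first maximises the number of classes, then
  minimises the number of singleton classes, and then minimises the size of the largest class of
  the refinement obtained by also taking adjacencies to the singleton classes into account.
  Spoiler starts with this list. Unless he wins within two further moves, the reply of Duplicator is
  optimal as well and yields the same classes and the same singletons; by maximality, the adjacency
  of two vertices in non-singleton classes depends only on their classes. So the graphs are
  isomorphic unless some refined class has \<open>m\<close> vertices in Spoiler's graph and \<open>m' < m\<close> vertices in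
  the other one. If \<open>s + m' + 2 \<le> (n + 5) / 2\<close>, then Spoiler wins by playing \<open>m' + 1\<close> vertices of
  this class. Otherwise, because of the many classes, it is a largest one in Duplicator's
  graph, whose largest class is then smaller than that of Spoiler's graph, against the choice of \<open>xs\<close>.
\<close>

section \<open>The one-sided Ehrenfeucht game\<close>

text \<open>Positions are sets of pairs, so the order and repetition of moves are forgotten; the
  equivalence of equalities makes \<open>P\<close> the graph of an injective partial map.\<close>

definition partial_iso :: "'a pair_pre_digraph \<Rightarrow> 'b pair_pre_digraph \<Rightarrow> ('a \<times> 'b) set \<Rightarrow> bool" where
  "partial_iso G G' P \<longleftrightarrow> (\<forall>a a' b b'. (a, a') \<in> P \<longrightarrow> (b, b') \<in> P \<longrightarrow>
     (a = b \<longleftrightarrow> a' = b') \<and> ((a, b) \<in> parcs G \<longleftrightarrow> (a', b') \<in> parcs G'))"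

lemma partial_isoD:
  assumes "partial_iso G G' P" "(a, a') \<in> P" "(b, b') \<in> P"
  shows "a = b \<longleftrightarrow> a' = b'" "(a, b) \<in> parcs G \<longleftrightarrow> (a', b') \<in> parcs G'"
  using assms(1)[unfolded partial_iso_def, rule_format, OF assms(2,3)] by simp_all

lemma partial_iso_subset: "partial_iso G G' P \<Longrightarrow> Q \<subseteq> P \<Longrightarrow> partial_iso G G' Q"
  unfolding partial_iso_def by blast

text \<open>Duplicator survives \<open>k\<close> more rounds of the game in which Spoiler always plays in \<open>G\<close>.\<close>

primrec survives :: "'a pair_pre_digraph \<Rightarrow> 'b pair_pre_digraph \<Rightarrow> nat \<Rightarrow> ('a \<times> 'b) set \<Rightarrow> bool" where
  "survives G G' 0 P \<longleftrightarrow> partial_iso G G' P"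
| "survives G G' (Suc k) P \<longleftrightarrow> partial_iso G G' P \<and>
     (\<forall>a\<in>pverts G. \<exists>a'\<in>pverts G'. survives G G' k (insert (a, a') P))"

lemma survives_partial_iso: "survives G G' k P \<Longrightarrow> partial_iso G G' P"
  by (cases k) auto

lemma survives_list:
  assumes "survives G G' (k + length us) P" "set us \<subseteq> pverts G"
  shows "\<exists>us'. length us' = length us \<and> set us' \<subseteq> pverts G' \<and>
    survives G G' k (P \<union> set (zip us us'))"
  using assms
proof (induction us arbitrary: P)
  case (Cons a us)
  then obtain a' where a': "a' \<in> pverts G'" "survives G G' (k + length us) (insert (a, a') P)"
    by auto
  with Cons obtain us' where us': "length us' = length us" "set us' \<subseteq> pverts G'"
    "survives G G' k (insert (a, a') P \<union> set (zip us us'))"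
    by (metis list.set_intros(2) subset_iff)
  then show ?case
    using a' by (intro exI[of _ "a' # us'"]) auto
qed simp

lemma survives_decrease: "survives G G' (k + j) P \<Longrightarrow> survives G G' k P"
proof (induction k arbitrary: P)
  case 0
  then show ?case by (simp add: survives_partial_iso)
next
  case (Suc k)
  then show ?case by simp blast
qed

section \<open>Existential formulas from winning strategies of Spoiler\<close>

definition existential :: "nat \<Rightarrow> fm \<Rightarrow> bool" where
  "existential k \<phi> \<longleftrightarrow> (\<forall>w\<in>Nest \<phi>. set w \<subseteq> {QExi} \<and> length w \<le> k)"

lemma existential_conjunction:
  assumes "finite A"
    and "\<And>a. a \<in> A \<Longrightarrow> \<exists>\<phi>. free_vars \<phi> \<subseteq> {..m} \<and> existential k \<phi> \<and> sat G v \<phi> \<and> \<not> sat G' (w a) \<phi>"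
  shows "\<exists>\<phi>. free_vars \<phi> \<subseteq> {..m} \<and> existential k \<phi> \<and> sat G v \<phi> \<and> (\<forall>a\<in>A. \<not> sat G' (w a) \<phi>)"
  using assms
proof (induction A rule: finite_induct)
  case empty
  then show ?case
    by (intro exI[of _ "Eql m m"]) (auto simp: existential_def)
next
  case (insert a A)
  then obtain \<phi> \<psi> where
    "free_vars \<phi> \<subseteq> {..m} \<and> existential k \<phi> \<and> sat G v \<phi> \<and> (\<forall>a\<in>A. \<not> sat G' (w a) \<phi>)"
    "free_vars \<psi> \<subseteq> {..m} \<and> existential k \<psi> \<and> sat G v \<psi> \<and> \<not> sat G' (w a) \<psi>"
    by (metis insert_iff)
  then show ?case
    by (intro exI[of _ "Conj \<phi> \<psi>"]) (auto simp: existential_def)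
qed

text \<open>Here a position is a list, since variable \<open>i\<close> names the pair
  \<open>ps ! i\<close>. A violated equivalence yields an atomic formula or the negation of
  one.\<close>

lemma not_partial_iso_formula:
  assumes "\<not> partial_iso G G' (set ps)"
  shows "\<exists>\<phi>. free_vars \<phi> \<subseteq> {..<length ps} \<and> existential k \<phi> \<and>
    sat G (\<lambda>i. fst (ps ! i)) \<phi> \<and> \<not> sat G' (\<lambda>i. snd (ps ! i)) \<phi>"
proof -
  obtain a a' b b' where "(a, a') \<in> set ps" "(b, b') \<in> set ps" and
    "\<not> ((a = b \<longleftrightarrow> a' = b') \<and> ((a, b) \<in> parcs G \<longleftrightarrow> (a', b') \<in> parcs G'))"
    using assms unfolding partial_iso_def by blast
  moreover from this(1,2) obtain i j where "i < length ps" "ps ! i = (a, a')" "j < length ps" "ps ! j = (b, b')"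
    unfolding in_set_conv_nth by blast
  ultimately obtain i j where ij: "i < length ps" "j < length ps" and
    "\<not> ((fst (ps ! i) = fst (ps ! j) \<longleftrightarrow> snd (ps ! i) = snd (ps ! j)) \<and>
      ((fst (ps ! i), fst (ps ! j)) \<in> parcs G \<longleftrightarrow> (snd (ps ! i), snd (ps ! j)) \<in> parcs G'))"
    using that[of i j] by simp
  then consider
      "sat G (\<lambda>i. fst (ps ! i)) (Eql i j)" "\<not> sat G' (\<lambda>i. snd (ps ! i)) (Eql i j)"
    | "sat G (\<lambda>i. fst (ps ! i)) (Neg (Eql i j))" "\<not> sat G' (\<lambda>i. snd (ps ! i)) (Neg (Eql i j))"
    | "sat G (\<lambda>i. fst (ps ! i)) (Adj i j)" "\<not> sat G' (\<lambda>i. snd (ps ! i)) (Adj i j)"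
    | "sat G (\<lambda>i. fst (ps ! i)) (Neg (Adj i j))" "\<not> sat G' (\<lambda>i. snd (ps ! i)) (Neg (Adj i j))"
    by auto
  then show ?thesis
  proof cases
    case 1 then show ?thesis using ij by (intro exI[of _ "Eql i j"]) (auto simp: existential_def)
  next
    case 2 then show ?thesis using ij by (intro exI[of _ "Neg (Eql i j)"]) (auto simp: existential_def)
  next
    case 3 then show ?thesis using ij by (intro exI[of _ "Adj i j"]) (auto simp: existential_def)
  next
    case 4 then show ?thesis using ij by (intro exI[of _ "Neg (Adj i j)"]) (auto simp: existential_def)
  qed
qed

text \<open>Unless the position is already lost for Duplicator, Spoiler's winning move is the
  witness of an existential quantifier over the fresh variable \<open>length ps\<close>; its body is
  the conjunction, over the finitely many replies, of the formulas from the induction.\<close>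

lemma not_survives_formula:
  assumes "finite (pverts G')" "\<not> survives G G' k (set ps)"
  shows "\<exists>\<phi>. free_vars \<phi> \<subseteq> {..<length ps} \<and> existential k \<phi> \<and>
    sat G (\<lambda>i. fst (ps ! i)) \<phi> \<and> \<not> sat G' (\<lambda>i. snd (ps ! i)) \<phi>"
  using assms(2)
proof (induction k arbitrary: ps)
  case 0
  then show ?case by (simp add: not_partial_iso_formula)
next
  case (Suc k)
  show ?case
  proof (cases "partial_iso G G' (set ps)")
    case False
    then show ?thesis by (rule not_partial_iso_formula)
  next
    case True
    let ?m = "length ps" and ?v = "\<lambda>i. fst (ps ! i)" and ?w = "\<lambda>i. snd (ps ! i)"
    obtain a where a: "a \<in> pverts G"
      and win: "\<And>a'. a' \<in> pverts G' \<Longrightarrow> \<not> survives G G' k (insert (a, a') (set ps))"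
      using Suc.prems True by auto
    have "\<exists>\<phi>. free_vars \<phi> \<subseteq> {..?m} \<and> existential k \<phi> \<and>
        sat G (?v(?m := a)) \<phi> \<and> \<not> sat G' (?w(?m := a')) \<phi>" if a': "a' \<in> pverts G'" for a'
    proof -
      obtain \<phi> where \<phi>: "free_vars \<phi> \<subseteq> {..<Suc ?m}" "existential k \<phi>"
        "sat G (\<lambda>i. fst ((ps @ [(a, a')]) ! i)) \<phi>" "\<not> sat G' (\<lambda>i. snd ((ps @ [(a, a')]) ! i)) \<phi>"
        using Suc.IH[of "ps @ [(a, a')]"] win[OF a'] by auto
      \<comment> \<open>The two valuations agree on the variables up to \<open>?m\<close>; beyond
        the list its lookup is unspecified.\<close>
      have "sat G (\<lambda>i. fst ((ps @ [(a, a')]) ! i)) \<phi> = sat G (?v(?m := a)) \<phi>"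
        using \<phi>(1) by (intro sat_cong_free_vars) (auto simp: nth_append less_Suc_eq)
      moreover have "sat G' (\<lambda>i. snd ((ps @ [(a, a')]) ! i)) \<phi> = sat G' (?w(?m := a')) \<phi>"
        using \<phi>(1) by (intro sat_cong_free_vars) (auto simp: nth_append less_Suc_eq)
      ultimately show ?thesis using \<phi> by (auto simp: lessThan_Suc_atMost)
    qed
    then have "\<exists>\<phi>. free_vars \<phi> \<subseteq> {..?m} \<and> existential k \<phi> \<and> sat G (?v(?m := a)) \<phi> \<and>
        (\<forall>a'\<in>pverts G'. \<not> sat G' (?w(?m := a')) \<phi>)"
      by (rule existential_conjunction[OF assms(1)])
    then obtain \<phi> where \<phi>: "free_vars \<phi> \<subseteq> {..?m}" "existential k \<phi>" "sat G (?v(?m := a)) \<phi>"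
      "\<forall>a'\<in>pverts G'. \<not> sat G' (?w(?m := a')) \<phi>"
      by blast
    then show ?thesis
      using a by (intro exI[of _ "Exi ?m \<phi>"]) (auto simp: existential_def)
  qed
qed

lemma not_survives_closed_formula:
  assumes "finite (pverts G')" "\<not> survives G G' k {}"
  obtains \<phi> v w where "free_vars \<phi> = {}" "existential k \<phi>" "sat G v \<phi>" "\<not> sat G' w \<phi>"
proof -
  have "\<not> survives G G' k (set [])" using assms(2) by simp
  from not_survives_formula[OF assms(1) this] that show thesis
    unfolding list.size(3) lessThan_0 subset_empty by blast
qed

section \<open>From formulas to the bound on \<open>D0\<close>\<close>

lemma finite_Nest: "finite (Nest \<phi>)" and Nest_nonempty: "Nest \<phi> \<noteq> {}"
  by (induction \<phi>) auto

lemma word_alternations_constant: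
  assumes "set w \<subseteq> {q}"
  shows "word_alternations w = 0"
proof -
  have "w ! i = q" if "i < length w" for i
    using assms nth_mem[OF that] by blast
  then show ?thesis
    unfolding word_alternations_def by (cases q) (auto simp: card_eq_0_iff)
qed

lemma distinguishesI:
  assumes "free_vars \<phi> = {}" "sat G v \<phi>" "\<not> sat G' w \<phi>"
  shows "distinguishes \<phi> G G'"
proof -
  have closed: "closed_fm \<phi>" using assms(1) by (simp add: closed_fm_def)
  show ?thesis
    unfolding distinguishes_def models_closed[OF closed, of G v] models_closed[OF closed, of G' w]
    using closed assms by simp
qed

lemma D0_leI:
  assumes "distinguishes \<phi> G G'" "\<And>w. w \<in> Nest \<phi> \<Longrightarrow> set w \<subseteq> {q} \<and> length w \<le> k"
  shows "D0 G G' \<le> enat k"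
proof -
  have "word_alternations ` Nest \<phi> = {0}"
    using assms(2) Nest_nonempty[of \<phi>] word_alternations_constant by force
  then have "alternation_number \<phi> = 0"
    by (simp add: alternation_number_def)
  then have "D0 G G' \<le> enat (quantifier_rank \<phi>)"
    unfolding D0_def using assms(1) by (intro INF_lower) simp
  also have "quantifier_rank \<phi> \<le> k"
    unfolding quantifier_rank_def using assms(2) finite_Nest[of \<phi>] Nest_nonempty[of \<phi>] by auto
  finally show ?thesis by simp
qed

text \<open>A win in \<open>G\<close> gives an existential formula true on \<open>G\<close>. A win
  in \<open>G'\<close> gives one true on \<open>G'\<close>; its negation is true on \<open>G\<close>
  and has only universal nesting words.\<close>

lemma D0_le_if_Spoiler_wins:
  assumes "finite (pverts G)" "finite (pverts G')"
    and "\<not> survives G G' k {} \<or> \<not> survives G' G k {}"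
  shows "D0 G G' \<le> enat k"
  using assms(3)
proof
  assume "\<not> survives G G' k {}"
  with assms(2) obtain \<phi> v w where \<phi>:
    "free_vars \<phi> = {}" "existential k \<phi>" "sat G v \<phi>" "\<not> sat G' w \<phi>"
    by (rule not_survives_closed_formula)
  from \<phi>(1,3,4) have "distinguishes \<phi> G G'" by (rule distinguishesI)
  then show ?thesis
    using \<phi>(2) D0_leI[of \<phi> G G' QExi k] by (simp add: existential_def)
next
  assume "\<not> survives G' G k {}"
  with assms(1) obtain \<phi> v w where \<phi>:
    "free_vars \<phi> = {}" "existential k \<phi>" "sat G' v \<phi>" "\<not> sat G w \<phi>"
    by (rule not_survives_closed_formula)
  have "distinguishes (Neg \<phi>) G G'"
    by (rule distinguishesI[of _ _ w _ v]) (simp_all add: \<phi>)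
  moreover have "set w \<subseteq> {QUni} \<and> length w \<le> k" if "w \<in> Nest (Neg \<phi>)" for w
  proof -
    from that obtain u where "u \<in> Nest \<phi>" "w = map swap_quant u" by auto
    moreover from this(1) have "set u \<subseteq> {QExi}" "length u \<le> k"
      using \<phi>(2) by (auto simp: existential_def)
    ultimately show ?thesis by auto
  qed
  ultimately show ?thesis by (rule D0_leI)
qed

section \<open>Partitions induced by a vertex list\<close>

lemma finite_pverts: "pair_graph G \<Longrightarrow> finite (pverts G)"
  using pair_fin_digraph.pair_finite_verts unfolding pair_graph_def pair_digraph_def by blast

lemma parcs_commute:
  assumes "pair_graph G"
  shows "(u, v) \<in> parcs G \<longleftrightarrow> (v, u) \<in> parcs G"
proof -
  interpret pair_graph G by fact
  show ?thesis
    using pair_sym_arcs by (auto simp: symmetric_def dest: symD)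
qed

definition rest :: "'a pair_pre_digraph \<Rightarrow> 'a list \<Rightarrow> 'a set" where
  "rest G xs = pverts G - set xs"

text \<open>Indexed by position in the list, so that types relative to Spoiler's list and to the
  list of replies can be compared.\<close>

definition ctype :: "'a pair_pre_digraph \<Rightarrow> 'a list \<Rightarrow> 'a \<Rightarrow> bool list" where
  "ctype G xs v = map (\<lambda>x. (x, v) \<in> parcs G) xs"

definition ctypes :: "'a pair_pre_digraph \<Rightarrow> 'a list \<Rightarrow> bool list set" where
  "ctypes G xs = ctype G xs ` rest G xs"

definition solo :: "'a pair_pre_digraph \<Rightarrow> 'a list \<Rightarrow> bool list set" where
  "solo G xs = {c. \<exists>!v. v \<in> rest G xs \<and> ctype G xs v = c}"

text \<open>
  Two vertices have equal \<open>dtype\<close> iff they have the same adjacencies to \<open>xs\<close> and to the vertices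
  whose \<open>ctype\<close> is unique. Such a vertex is named by its \<open>ctype\<close>, so that values of \<open>dtype\<close> can be
  compared across graphs.
\<close>

definition dtype :: "'a pair_pre_digraph \<Rightarrow> 'a list \<Rightarrow> 'a \<Rightarrow> bool list \<times> bool list set" where
  "dtype G xs v = (ctype G xs v,
     {c \<in> solo G xs. \<exists>y\<in>rest G xs. ctype G xs y = c \<and> (y, v) \<in> parcs G})"

definition dclass :: "'a pair_pre_digraph \<Rightarrow> 'a list \<Rightarrow> bool list \<times> bool list set \<Rightarrow> 'a set" where
  "dclass G xs d = {v \<in> rest G xs. dtype G xs v = d}"

definition dmax :: "'a pair_pre_digraph \<Rightarrow> 'a list \<Rightarrow> nat" where
  "dmax G xs = Max (range (\<lambda>d. card (dclass G xs d)))"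

text \<open>The excess of classes over pebbles limits the sizes of two large classes, and it
  persists when a vertex is appended that increases the number of classes.\<close>

definition admissible :: "'a pair_pre_digraph \<Rightarrow> 'a list \<Rightarrow> bool" where
  "admissible G xs \<longleftrightarrow> distinct xs \<and> set xs \<subseteq> pverts G \<and> length xs < card (ctypes G xs)"

text \<open>Compared lexicographically and minimised; the subtraction makes more classes cheaper.
  Lists in two graphs of the same order can be compared.\<close>

definition cost :: "'a pair_pre_digraph \<Rightarrow> 'a list \<Rightarrow> nat \<times> nat \<times> nat" where
  "cost G xs = (card (pverts G) - card (ctypes G xs), card (solo G xs), dmax G xs)"

lemma solo_subset_ctypes: "solo G xs \<subseteq> ctypes G xs"
  unfolding solo_def ctypes_def by blast

lemma soloD:
  "\<lbrakk>c \<in> solo G xs; v \<in> rest G xs; w \<in> rest G xs; ctype G xs v = c; ctype G xs w = c\<rbrakk> \<Longrightarrow> v = w"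
  unfolding solo_def by blast

lemma card_rest:
  "finite (pverts G) \<Longrightarrow> distinct xs \<Longrightarrow> set xs \<subseteq> pverts G \<Longrightarrow>
    card (rest G xs) = card (pverts G) - length xs"
  unfolding rest_def by (simp add: card_Diff_subset distinct_card)

lemma card_ctypes_le: "finite (pverts G) \<Longrightarrow> card (ctypes G xs) \<le> card (rest G xs)"
  unfolding ctypes_def rest_def by (simp add: card_image_le)

lemma finite_range_card_dclass:
  assumes "finite (pverts G)"
  shows "finite (range (\<lambda>d. card (dclass G xs d)))"
proof (rule finite_subset)
  show "range (\<lambda>d. card (dclass G xs d)) \<subseteq> {..card (pverts G)}"
    using assms by (auto simp: dclass_def rest_def intro!: card_mono)
qed simp

lemma card_dclass_le_dmax: "finite (pverts G) \<Longrightarrow> card (dclass G xs d) \<le> dmax G xs"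
  unfolding dmax_def by (intro Max_ge finite_range_card_dclass) auto

lemma dmax_leI: "finite (pverts G) \<Longrightarrow> (\<And>d. card (dclass G xs d) \<le> m) \<Longrightarrow> dmax G xs \<le> m"
  unfolding dmax_def using finite_range_card_dclass[of G xs] by (subst Max_le_iff) auto

text \<open>
  The two classes realise at most two types, so at least \<open>card (ctypes G xs) - 2\<close> vertices lie
  outside of them.
\<close>

lemma card_two_dclasses:
  assumes fin: "finite (pverts G)" and adm: "admissible G xs" and "d \<noteq> e"
  shows "2 * length xs + card (dclass G xs d) + card (dclass G xs e) \<le> card (pverts G) + 1"
proof -
  let ?R = "rest G xs" and ?D = "dclass G xs d" and ?E = "dclass G xs e"
  have finR: "finite ?R" using fin by (simp add: rest_def)
  have sub: "?D \<union> ?E \<subseteq> ?R" by (auto simp: dclass_def)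
  have cDE: "card (?D \<union> ?E) = card ?D + card ?E"
    using assms(3) finR by (intro card_Un_disjoint) (auto simp: dclass_def)
  \<comment> \<open>All vertices of a refined class share one \<open>ctype\<close>, the first
    component of its name.\<close>
  have "ctypes G xs \<subseteq> {fst d, fst e} \<union> ctype G xs ` (?R - (?D \<union> ?E))"
    by (auto simp: ctypes_def dclass_def dtype_def)
  then have "card (ctypes G xs) \<le> card ({fst d, fst e} \<union> ctype G xs ` (?R - (?D \<union> ?E)))"
    using finR by (intro card_mono) auto
  also have "\<dots> \<le> card {fst d, fst e} + card (ctype G xs ` (?R - (?D \<union> ?E)))"
    by (rule card_Un_le)
  also have "\<dots> \<le> 2 + card (?R - (?D \<union> ?E))"
    using finR by (intro add_mono card_image_le) (auto simp: card_insert_if)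
  also have "card (?R - (?D \<union> ?E)) = card ?R - (card ?D + card ?E)"
    using sub finR cDE by (metis card_Diff_subset finite_subset)
  finally have "card (ctypes G xs) \<le> 2 + (card ?R - (card ?D + card ?E))" .
  moreover have "card ?D + card ?E \<le> card ?R"
    using card_mono[OF finR sub] cDE by simp
  moreover have "length xs < card (ctypes G xs)" and dist: "distinct xs" "set xs \<subseteq> pverts G"
    using adm by (auto simp: admissible_def)
  moreover have "card ?R = card (pverts G) - length xs"
    using dist by (rule card_rest[OF fin])
  moreover have "length xs \<le> card (pverts G)"
    using card_mono[OF fin dist(2)] distinct_card[OF dist(1)] by simp
  ultimately show ?thesis by linarith
qed

text \<open>Otherwise appending \<open>u\<close> to \<open>xs\<close> would keep all types and split that of \<open>v\<close> and \<open>w\<close>.\<close>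

lemma homogeneous:
  assumes graph: "pair_graph G" and adm: "admissible G xs"
    and maximal: "\<And>ys. admissible G ys \<Longrightarrow> card (ctypes G ys) \<le> card (ctypes G xs)"
    and u: "u \<in> rest G xs" "ctype G xs u \<notin> solo G xs"
    and vw: "v \<in> rest G xs" "w \<in> rest G xs" "u \<noteq> v" "u \<noteq> w" "ctype G xs v = ctype G xs w"
  shows "(u, v) \<in> parcs G \<longleftrightarrow> (u, w) \<in> parcs G"
proof (rule ccontr)
  assume differ: "\<not> ?thesis"
  interpret pair_graph G by fact
  define ys where "ys = xs @ [u]"
  have rest_ys: "rest G ys = rest G xs - {u}"
    by (auto simp: ys_def rest_def)
  have fin: "finite (ctypes G ys)"
    using pair_finite_verts by (simp add: ctypes_def rest_def)
  have split: "ctype G ys v \<noteq> ctype G ys w"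
    using differ by (simp add: ys_def ctype_def)
  have but: "butlast (ctype G ys r) = ctype G xs r" for r
    by (simp add: ys_def ctype_def)
  \<comment> \<open>A second vertex of the class of \<open>u\<close> keeps that type realised once
    \<open>u\<close> has moved into the list.\<close>
  obtain u2 where u2: "u2 \<in> rest G xs" "u2 \<noteq> u" "ctype G xs u2 = ctype G xs u"
    using u unfolding solo_def by auto
  \<comment> \<open>Forgetting the last entry recovers every old type, even without the new type of
    \<open>v\<close>, because \<open>w\<close> stands in for it.\<close>
  have "ctypes G xs \<subseteq> butlast ` (ctypes G ys - {ctype G ys v})"
  proof
    fix c assume "c \<in> ctypes G xs"
    then obtain r where r: "r \<in> rest G ys" "ctype G xs r = c"
      unfolding ctypes_def using u2 rest_ys by (metis DiffI imageE singletonD)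
    show "c \<in> butlast ` (ctypes G ys - {ctype G ys v})"
    proof (cases "ctype G ys r = ctype G ys v")
      case True
      then have "ctype G xs w = c" using r vw(5) but by metis
      then show ?thesis
        using split vw rest_ys but[of w] by (intro image_eqI[of _ _ "ctype G ys w"]) (auto simp: ctypes_def)
    next
      case False
      then show ?thesis
        using r but[of r] by (intro image_eqI[of _ _ "ctype G ys r"]) (auto simp: ctypes_def)
    qed
  qed
  then have "card (ctypes G xs) \<le> card (ctypes G ys - {ctype G ys v})"
    using fin by (intro surj_card_le) auto
  moreover have "ctype G ys v \<in> ctypes G ys"
    using vw rest_ys by (auto simp: ctypes_def)
  ultimately have less: "card (ctypes G xs) < card (ctypes G ys)"
    using fin by (metis card_Diff1_less le_less_trans)
  then have "admissible G ys"
    using adm u(1) by (auto simp: admissible_def ys_def rest_def)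
  with maximal less show False by fastforce
qed

section \<open>Optimal lists\<close>

lemma digraph_isoI:
  assumes "pair_graph G" "pair_graph G'" and bij: "bij_betw h (pverts G) (pverts G')"
    and adj: "\<And>u v. u \<in> pverts G \<Longrightarrow> v \<in> pverts G \<Longrightarrow> (u, v) \<in> parcs G \<longleftrightarrow> (h u, h v) \<in> parcs G'"
  shows "digraph_iso (with_proj G) (with_proj G')"
proof -
  interpret G: pair_graph G by fact
  interpret G': pair_graph G' by fact
  define hom where "hom = \<lparr>iso_verts = h, iso_arcs = map_prod h h,
    iso_head = (snd :: 'b \<times> 'b \<Rightarrow> 'b), iso_tail = (fst :: 'b \<times> 'b \<Rightarrow> 'b)\<rparr>"
  have inj: "inj_on h (pverts G)" and img: "h ` pverts G = pverts G'"
    using bij by (auto simp: bij_betw_def)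
  have "inj_on (map_prod h h) (parcs G)"
    by (rule inj_on_subset[OF map_prod_inj_on[OF inj inj]]) (auto dest: G.in_arcsD1 G.in_arcsD2)
  then have "pre_digraph.digraph_isomorphism (with_proj G) hom"
    unfolding pre_digraph.digraph_isomorphism_def
    using inj by (auto simp: hom_def wf_digraph_wp_iff)
  moreover have "parcs G' = map_prod h h ` parcs G"
  proof (intro equalityI subrelI)
    fix a b assume ab: "(a, b) \<in> parcs G'"
    then obtain u v where "u \<in> pverts G" "v \<in> pverts G" "a = h u" "b = h v"
      using G'.in_arcsD1 G'.in_arcsD2 img by (metis imageE)
    with ab adj show "(a, b) \<in> map_prod h h ` parcs G" by force
  next
    fix a b assume "(a, b) \<in> map_prod h h ` parcs G"
    then show "(a, b) \<in> parcs G'"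
      using adj by (auto dest: G.in_arcsD1 G.in_arcsD2)
  qed
  then have "with_proj G' = app_iso hom (with_proj G)"
    using img by (simp add: app_iso_def hom_def with_proj_def)
  ultimately show ?thesis unfolding digraph_iso_def by blast
qed

text \<open>Fibres of equal size are in bijection, and bijections between disjoint fibres can be
  glued.\<close>

lemma bij_betw_fibres:
  assumes "finite A" "finite B" "\<And>d. card {a \<in> A. p a = d} = card {b \<in> B. q b = d}"
  shows "\<exists>f. bij_betw f A B \<and> (\<forall>a\<in>A. q (f a) = p a)"
proof -
  have "\<exists>f. bij_betw f {a \<in> A. p a = d} {b \<in> B. q b = d}" for d
    using assms by (intro finite_same_card_bij) auto
  then obtain F where F: "\<And>d. bij_betw (F d) {a \<in> A. p a = d} {b \<in> B. q b = d}"
    by metis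
  have mem: "F (p a) a \<in> B \<and> q (F (p a) a) = p a" if "a \<in> A" for a
    using bij_betwE[OF F[of "p a"]] that by simp
  have "inj_on (\<lambda>a. F (p a) a) A"
  proof (rule inj_onI)
    fix a b assume ab: "a \<in> A" "b \<in> A" "F (p a) a = F (p b) b"
    then have "p a = p b" using mem by metis
    then show "a = b"
      using ab bij_betw_imp_inj_on[OF F[of "p a"]] by (auto dest: inj_onD)
  qed
  moreover have "b \<in> (\<lambda>a. F (p a) a) ` A" if "b \<in> B" for b
    using bij_betw_imp_surj_on[OF F[of "q b"]] that by force
  ultimately have "bij_betw (\<lambda>a. F (p a) a) A B"
    unfolding bij_betw_def using mem by blast
  then show ?thesis using mem by blast
qed

section \<open>Duplicator survives an optimal list\<close>

text \<open>Spoiler has played \<open>xs\<close> in \<open>G\<close>, and \<open>xs'\<close> are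
  replies after which Duplicator survives the rest of the \<open>K\<close> rounds. Optimality is
  stated against lists of \<open>G'\<close>, because it is applied to \<open>xs'\<close> and its
  extensions.\<close>

locale optimal_list =
  fixes G :: "'a pair_pre_digraph" and G' :: "'b pair_pre_digraph"
    and n K :: nat and xs :: "'a list" and xs' :: "'b list"
  assumes graph: "pair_graph G" and graph': "pair_graph G'"
    and card_G: "card (pverts G) = n" and card_G': "card (pverts G') = n"
    and K_def: "K = (n + 5) div 2"
    and adm: "admissible G xs"
    and optimal: "\<And>ys. admissible G' ys \<Longrightarrow> cost G xs \<le> cost G' ys"
    and len: "length xs' = length xs"
    and verts': "set xs' \<subseteq> pverts G'"
    and surv: "survives G G' (K - length xs) (set (zip xs xs'))"
begin

lemma fin: "finite (pverts G)" and fin': "finite (pverts G')"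
  using graph graph' by (simp_all add: finite_pverts)

lemma finite_ctypes: "finite (ctypes G xs)" and finite_ctypes': "finite (ctypes G' xs')"
  using fin fin' by (simp_all add: ctypes_def rest_def)

lemma distinct_xs: "distinct xs" and set_xs: "set xs \<subseteq> pverts G"
  using adm by (auto simp: admissible_def)

lemma piso: "partial_iso G G' (set (zip xs xs'))"
  using surv by (rule survives_partial_iso)

lemma nth_zip_mem: "i < length xs \<Longrightarrow> (xs ! i, xs' ! i) \<in> set (zip xs xs')"
  using len by (auto simp: in_set_zip)

lemma distinct_xs': "distinct xs'"
  unfolding distinct_conv_nth
proof (intro allI impI)
  fix i j assume "i < length xs'" "j < length xs'" "i \<noteq> j"
  then show "xs' ! i \<noteq> xs' ! j"
    using partial_isoD(1)[OF piso nth_zip_mem nth_zip_mem, of i j] len distinct_xs nth_eq_iff_index_eq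
    by metis
qed

text \<open>More than \<open>length xs\<close> types need as many vertices outside the list, so
  \<open>2 * length xs + 1 \<le> n\<close>.\<close>

lemma rounds: "length xs + 3 \<le> K"
  using adm card_ctypes_le[OF fin, of xs] card_rest[OF fin distinct_xs set_xs] card_G
  unfolding admissible_def K_def by linarith

section \<open>Replies of Duplicator\<close>

lemma reply_ctype:
  assumes "partial_iso G G' P" "insert (v, v') (set (zip xs xs')) \<subseteq> P"
    and "v \<in> rest G xs" "v' \<in> pverts G'"
  shows "v' \<in> rest G' xs'" "ctype G' xs' v' = ctype G xs v"
proof -
  have *: "xs ! i = v \<longleftrightarrow> xs' ! i = v'"
      "(xs ! i, v) \<in> parcs G \<longleftrightarrow> (xs' ! i, v') \<in> parcs G'" if "i < length xs" for i
    using partial_isoD[OF assms(1), of "xs ! i" "xs' ! i" v v'] nth_zip_mem[OF that] assms(2) by auto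
  show "v' \<in> rest G' xs'"
    using * assms(3,4) len unfolding rest_def by (metis Diff_iff in_set_conv_nth)
  show "ctype G' xs' v' = ctype G xs v"
    using * len by (auto simp: ctype_def intro: nth_equalityI)
qed

lemma reply:
  assumes "set us \<subseteq> rest G xs" "length xs + length us + k \<le> K"
  shows "\<exists>us'. length us' = length us \<and>
    (\<forall>i < length us. us' ! i \<in> rest G' xs' \<and> ctype G' xs' (us' ! i) = ctype G xs (us ! i)) \<and>
    survives G G' k (set (zip xs xs') \<union> set (zip us us'))"
proof -
  have "K - length xs = k + length us + (K - length xs - length us - k)"
    using assms(2) by simp
  then have "survives G G' (k + length us) (set (zip xs xs'))"
    using surv survives_decrease by metis
  then obtain us' where us': "length us' = length us" "set us' \<subseteq> pverts G'"
    "survives G G' k (set (zip xs xs') \<union> set (zip us us'))"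
    using survives_list assms(1) unfolding rest_def by (metis Diff_subset subset_trans)
  have "us' ! i \<in> rest G' xs' \<and> ctype G' xs' (us' ! i) = ctype G xs (us ! i)" if i: "i < length us" for i
  proof -
    have "(us ! i, us' ! i) \<in> set (zip us us')"
      using i us'(1) by (auto simp: in_set_zip)
    moreover have "us ! i \<in> rest G xs" "us' ! i \<in> pverts G'"
      using i us'(1,2) assms(1) by (metis nth_mem subsetD)+
    ultimately show ?thesis
      using reply_ctype[OF survives_partial_iso[OF us'(3)]] by blast
  qed
  with us' show ?thesis by blast
qed

lemma reply_one:
  assumes "survives G G' (Suc k) P" "set (zip xs xs') \<subseteq> P" "y \<in> rest G xs"
  shows "\<exists>y'\<in>rest G' xs'. ctype G' xs' y' = ctype G xs y \<and> partial_iso G G' (insert (y, y') P)"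
proof -
  obtain y' where y': "y' \<in> pverts G'" "survives G G' k (insert (y, y') P)"
    using assms(1,3) by (auto simp: rest_def)
  note iso = survives_partial_iso[OF y'(2)]
  show ?thesis
    using reply_ctype[OF iso _ assms(3) y'(1)] assms(2) iso by blast
qed

text \<open>Spoiler spends two further moves on \<open>u\<close> and \<open>v\<close>. The case
  \<open>u = v\<close> serves for a single vertex.\<close>

lemma reply_pair:
  assumes "u \<in> rest G xs" "v \<in> rest G xs"
  obtains u' v' where "u' \<in> rest G' xs'" "v' \<in> rest G' xs'"
    "ctype G' xs' u' = ctype G xs u" "ctype G' xs' v' = ctype G xs v"
    "u = v \<longleftrightarrow> u' = v'" "(u, v) \<in> parcs G \<longleftrightarrow> (u', v') \<in> parcs G'"
proof -
  obtain us' where us': "length us' = 2"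
    "\<forall>i < 2. us' ! i \<in> rest G' xs' \<and> ctype G' xs' (us' ! i) = ctype G xs ([u, v] ! i)"
    "survives G G' 0 (set (zip xs xs') \<union> set (zip [u, v] us'))"
    using reply[of "[u, v]" 0] assms rounds by (auto simp: numeral_2_eq_2)
  obtain u' v' where [simp]: "us' = [u', v']"
    using us'(1) by (metis length_0_conv length_Suc_conv numeral_2_eq_2)
  have "partial_iso G G' (set (zip [u, v] us'))"
    using survives_partial_iso[OF us'(3)] by (rule partial_iso_subset) simp
  then have iso: "u = v \<longleftrightarrow> u' = v'" "(u, v) \<in> parcs G \<longleftrightarrow> (u', v') \<in> parcs G'"
    using partial_isoD[of G G' _ u u' v v'] by simp_all
  have "u' \<in> rest G' xs' \<and> ctype G' xs' u' = ctype G xs u"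
    "v' \<in> rest G' xs' \<and> ctype G' xs' v' = ctype G xs v"
    using us'(2)[rule_format, of 0] us'(2)[rule_format, of 1] by auto
  then show thesis using that[OF _ _ _ _ iso] by blast
qed

section \<open>Agreement of types and singleton classes\<close>

lemma ctypes_subset: "ctypes G xs \<subseteq> ctypes G' xs'"
proof
  fix c assume "c \<in> ctypes G xs"
  then obtain v where v: "v \<in> rest G xs" "c = ctype G xs v" by (auto simp: ctypes_def)
  obtain v' where "v' \<in> rest G' xs'" "ctype G' xs' v' = c"
    using reply_pair[OF v(1) v(1)] v(2) by metis
  then show "c \<in> ctypes G' xs'" by (auto simp: ctypes_def)
qed

lemma adm': "admissible G' xs'"
  using adm card_mono[OF finite_ctypes' ctypes_subset] distinct_xs' verts' len
  by (auto simp: admissible_def)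

lemma ctypes_le:
  assumes "admissible G' ys" shows "card (ctypes G' ys) \<le> card (ctypes G xs)"
proof -
  \<comment> \<open>This keeps the truncated subtraction in \<open>cost\<close> from hiding a larger
    number of types.\<close>
  have "card (ctypes G' ys) \<le> n"
    using card_ctypes_le[OF fin', of ys] card_mono[OF fin', of "rest G' ys"] card_G'
    by (simp add: rest_def)
  then show ?thesis
    using optimal[OF assms] card_G card_G' by (auto simp: cost_def)
qed

lemma ctypes_eq: "ctypes G' xs' = ctypes G xs"
  using card_seteq[OF finite_ctypes' ctypes_subset ctypes_le[OF adm']] by (rule sym)

text \<open>Two vertices of one type in \<open>G\<close> receive two distinct replies of that type,
  so a type realised once in \<open>G'\<close> is realised only once in \<open>G\<close>.\<close>

lemma solo_subset: "solo G' xs' \<subseteq> solo G xs"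
proof
  fix c assume c: "c \<in> solo G' xs'"
  then have "c \<in> ctypes G xs" using solo_subset_ctypes ctypes_eq by blast
  then obtain u where u: "u \<in> rest G xs" "ctype G xs u = c" by (auto simp: ctypes_def)
  have "v = u" if v: "v \<in> rest G xs" "ctype G xs v = c" for v
    using reply_pair[OF v(1) u(1)] soloD[OF c] u(2) v(2) by metis
  with u show "c \<in> solo G xs" unfolding solo_def by blast
qed

text \<open>The first components of \<open>cost\<close> tie, so optimality compares the numbers of
  singleton classes.\<close>

lemma solo_eq: "solo G' xs' = solo G xs"
proof -
  have "card (solo G xs) \<le> card (solo G' xs')"
    using optimal[OF adm'] ctypes_eq card_G card_G' by (auto simp: cost_def)
  moreover have "finite (solo G xs)"
    using finite_ctypes solo_subset_ctypes finite_subset by blast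
  ultimately show ?thesis using card_seteq[OF _ solo_subset] by blast
qed

lemma dmax_le: "dmax G xs \<le> dmax G' xs'"
  using optimal[OF adm'] ctypes_eq solo_eq card_G card_G' by (auto simp: cost_def)

text \<open>The replies to \<open>u\<close> and \<open>v\<close> have the right adjacency. By
  homogeneity in \<open>G'\<close> they can be exchanged for \<open>a\<close> and \<open>b\<close>,
  one at a time, within their classes.\<close>

lemma same_pattern:
  assumes uv: "u \<in> rest G xs" "v \<in> rest G xs" "u \<noteq> v"
    and ab: "a \<in> rest G' xs'" "b \<in> rest G' xs'" "a \<noteq> b"
    and types: "ctype G' xs' a = ctype G xs u" "ctype G' xs' b = ctype G xs v"
    and big: "ctype G xs u \<notin> solo G xs" "ctype G xs v \<notin> solo G xs"
  shows "(u, v) \<in> parcs G \<longleftrightarrow> (a, b) \<in> parcs G'"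
proof -
  obtain u' v' where r: "u' \<in> rest G' xs'" "v' \<in> rest G' xs'"
    "ctype G' xs' u' = ctype G xs u" "ctype G' xs' v' = ctype G xs v"
    "u' \<noteq> v'" "(u, v) \<in> parcs G \<longleftrightarrow> (u', v') \<in> parcs G'"
    using reply_pair[OF uv(1,2)] uv(3) by metis
  have hom: "(x, y) \<in> parcs G' \<longleftrightarrow> (x, z) \<in> parcs G'"
    if "x \<in> rest G' xs'" "ctype G' xs' x \<notin> solo G xs" "y \<in> rest G' xs'" "z \<in> rest G' xs'"
      "x \<noteq> y" "x \<noteq> z" "ctype G' xs' y = ctype G' xs' z" for x y z
    using homogeneous[OF graph' adm' _ that(1) _ that(3-7)] ctypes_le ctypes_eq solo_eq that(2)
    by simp
  note sym = parcs_commute[OF graph']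
  show ?thesis
  proof (cases "u' = b")
    \<comment> \<open>Here all four vertices of \<open>G'\<close> have the same type, so
      \<open>v'\<close> is exchanged for \<open>a\<close> and the pair is reversed.\<close>
    case True
    then have "(u', v') \<in> parcs G' \<longleftrightarrow> (b, a) \<in> parcs G'"
      using hom[of b v' a] r ab types big by metis
    then show ?thesis using r(6) sym by metis
  next
    case False
    have "(u', v') \<in> parcs G' \<longleftrightarrow> (u', b) \<in> parcs G'"
      using hom[of u' v' b] r ab types big False by metis
    also have "\<dots> \<longleftrightarrow> (b, u') \<in> parcs G'" by (rule sym)
    also have "\<dots> \<longleftrightarrow> (b, a) \<in> parcs G'"
      using hom[of b u' a] r ab types big False by metis
    finally show ?thesis using r(6) sym by metis
  qed
qed

text \<open>
  Spoiler puts one pebble more into the class than \<open>G'\<close> can answer correctly. The wrong answer has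
  the right \<open>ctype\<close>, so it is exposed by a vertex of unique \<open>ctype\<close>.
\<close>

lemma small_dclass:
  assumes "length xs + card (dclass G' xs' d) + 2 \<le> K"
  shows "card (dclass G xs d) \<le> card (dclass G' xs' d)"
proof (rule ccontr)
  let ?m = "card (dclass G' xs' d)"
  assume "\<not> ?thesis"
  then have "Suc ?m \<le> card (dclass G xs d)" by simp
  then obtain U where U: "U \<subseteq> dclass G xs d" "card U = Suc ?m" "finite U"
    by (rule obtain_subset_with_card_n)
  then obtain us where us: "set us = U" "distinct us" "length us = Suc ?m"
    using finite_distinct_list distinct_card by metis
  have sub: "set us \<subseteq> rest G xs" using us(1) U(1) by (auto simp: dclass_def)
  \<comment> \<open>One round is held back for the vertex that exposes the wrong reply.\<close>
  obtain us' where us': "length us' = length us"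
    "\<forall>i < length us. us' ! i \<in> rest G' xs' \<and> ctype G' xs' (us' ! i) = ctype G xs (us ! i)"
    and surv1: "survives G G' 1 (set (zip xs xs') \<union> set (zip us us'))"
    using reply[OF sub, of 1] us(3) assms by auto
  let ?P = "set (zip xs xs') \<union> set (zip us us')"
  have mem: "(us ! i, us' ! i) \<in> ?P" if "i < length us" for i
    using that us'(1) by (auto simp: in_set_zip)
  have "distinct us'"
    unfolding distinct_conv_nth
  proof (intro allI impI)
    fix i j assume "i < length us'" "j < length us'" "i \<noteq> j"
    then show "us' ! i \<noteq> us' ! j"
      using partial_isoD(1)[OF survives_partial_iso[OF surv1] mem mem, of i j] us'(1) us(2)
        nth_eq_iff_index_eq by metis
  qed
  then have "card (set us') = Suc ?m" using us'(1) us(3) by (simp add: distinct_card)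
  moreover have "finite (dclass G' xs' d)" using fin' by (simp add: dclass_def rest_def)
  \<comment> \<open>The replies are distinct and outnumber the class, so one of them lies outside
    it.\<close>
  ultimately have "\<not> set us' \<subseteq> dclass G' xs' d" using card_mono[of "dclass G' xs' d" "set us'"] by auto
  then obtain i where i: "i < length us" "us' ! i \<notin> dclass G' xs' d"
    using us'(1) by (metis in_set_conv_nth subsetI)
  define v v' where "v = us ! i" and "v' = us' ! i"
  have v: "v \<in> rest G xs" "dtype G xs v = d"
    using i us(1) U(1) nth_mem[OF i(1)] by (auto simp: v_def dclass_def)
  have v': "v' \<in> rest G' xs'" "ctype G' xs' v' = ctype G xs v" "dtype G' xs' v' \<noteq> d"
    using us'(2) i by (auto simp: v_def v'_def dclass_def)
  have "dtype G xs v \<noteq> dtype G' xs' v'" using v(2) v'(3) by simp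
  moreover have "fst (dtype G xs v) = fst (dtype G' xs' v')"
    using v'(2) by (simp add: dtype_def)
  ultimately have "snd (dtype G xs v) \<noteq> snd (dtype G' xs' v')"
    unfolding prod_eq_iff by simp
  then obtain c where c: "c \<in> solo G xs" and differ:
    "(\<exists>y\<in>rest G xs. ctype G xs y = c \<and> (y, v) \<in> parcs G) \<noteq>
     (\<exists>y\<in>rest G' xs'. ctype G' xs' y = c \<and> (y, v') \<in> parcs G')"
    unfolding dtype_def snd_conv solo_eq by blast
  obtain y where y: "y \<in> rest G xs" "ctype G xs y = c"
    using c unfolding solo_def by blast
  \<comment> \<open>The reply to \<open>y\<close> must be the only vertex of type \<open>c\<close>
    in \<open>G'\<close>, where the adjacency is wrong.\<close>
  obtain y' where y': "y' \<in> rest G' xs'" "ctype G' xs' y' = c" "partial_iso G G' (insert (y, y') ?P)"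
    using reply_one[of 0, OF _ _ y(1)] surv1 y(2) by auto
  have "(y, v) \<in> parcs G \<longleftrightarrow> (y', v') \<in> parcs G'"
    using partial_isoD(2)[OF y'(3), of y y' v v'] mem[OF i(1)] by (simp add: v_def v'_def)
  then show False
    using differ soloD[OF c] soloD[OF c[folded solo_eq]] y y' by metis
qed

text \<open>
  If a class is too large for Spoiler's attack in \<open>G'\<close>, it is a largest class of \<open>G'\<close>, and optimality
  of \<open>dmax G xs\<close> bounds the corresponding class of \<open>G\<close>.
\<close>

lemma card_dclass_le: "card (dclass G xs d) \<le> card (dclass G' xs' d)"
proof (cases "length xs + card (dclass G' xs' d) + 2 \<le> K")
  case True
  then show ?thesis by (rule small_dclass)
next
  case False
  \<comment> \<open>Since \<open>2 * K \<ge> n + 4\<close>, the failed bound gives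
    \<open>2 * length xs + 2 * card (dclass G' xs' d) \<ge> n + 2\<close>. Two classes and twice the
    list total at most \<open>n + 1\<close>, so every other class is smaller.\<close>
  have "card (dclass G' xs' e) \<le> card (dclass G' xs' d)" for e
  proof (cases "d = e")
    case False
    then show ?thesis
      using card_two_dclasses[OF fin' adm' False] len card_G' K_def
        \<open>\<not> length xs + card (dclass G' xs' d) + 2 \<le> K\<close> by linarith
  qed simp
  then have "dmax G' xs' \<le> card (dclass G' xs' d)" by (rule dmax_leI[OF fin'])
  then show ?thesis
    using card_dclass_le_dmax[OF fin, of xs d] dmax_le by linarith
qed

text \<open>The classes partition sets of equal size, so the termwise inequalities cannot be
  strict.\<close>

lemma card_dclass_eq: "card (dclass G xs d) = card (dclass G' xs' d)"
proof -
  \<comment> \<open>Inserting \<open>d\<close> covers a class that is empty in both graphs.\<close>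
  define D where "D = insert d (dtype G xs ` rest G xs \<union> dtype G' xs' ` rest G' xs')"
  have finR: "finite (rest G xs)" "finite (rest G' xs')"
    using fin fin' by (simp_all add: rest_def)
  then have finD: "finite D" by (simp add: D_def)
  have "(\<Sum>e\<in>D. card (dclass G xs e)) = card (rest G xs)"
    using sum.group[OF finR(1) finD, of "dtype G xs" "\<lambda>_. 1::nat"] by (auto simp: D_def dclass_def)
  moreover have "(\<Sum>e\<in>D. card (dclass G' xs' e)) = card (rest G' xs')"
    using sum.group[OF finR(2) finD, of "dtype G' xs'" "\<lambda>_. 1::nat"] by (auto simp: D_def dclass_def)
  moreover have "card (rest G xs) = card (rest G' xs')"
    using card_rest[OF fin distinct_xs set_xs] card_rest[OF fin' distinct_xs' verts'] card_G card_G' len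
    by simp
  ultimately have "(\<Sum>e\<in>D. card (dclass G xs e)) = (\<Sum>e\<in>D. card (dclass G' xs' e))"
    by simp
  moreover have "d \<in> D" by (simp add: D_def)
  ultimately show ?thesis
    by (rule sum_mono_inv[OF _ card_dclass_le _ finD])
qed

text \<open>Pair the list with its replies by \<open>g\<close>, and the other vertices by a
  \<open>dtype\<close>-preserving bijection \<open>f\<close>. Adjacency is preserved inside the list
  by the partial isomorphism, towards the list by \<open>ctype\<close>, towards singleton classes by
  \<open>dtype\<close>, and otherwise by \<open>same_pattern\<close>.\<close>

lemma isomorphic: "digraph_iso (with_proj G) (with_proj G')"
proof -
  obtain f where f: "bij_betw f (rest G xs) (rest G' xs')"
    and f_type: "\<And>v. v \<in> rest G xs \<Longrightarrow> dtype G' xs' (f v) = dtype G xs v"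
    using bij_betw_fibres[of "rest G xs" "rest G' xs'" "dtype G xs" "dtype G' xs'"]
      card_dclass_eq fin fin' by (auto simp: dclass_def rest_def)
  have "\<forall>x\<in>set xs. \<exists>x'. (x, x') \<in> set (zip xs xs')"
    using nth_zip_mem unfolding all_set_conv_all_nth by blast
  from bchoice[OF this] obtain g where g: "\<And>x. x \<in> set xs \<Longrightarrow> (x, g x) \<in> set (zip xs xs')"
    by blast
  have g_inj: "inj_on g (set xs)"
    using partial_isoD(1)[OF piso g g] by (auto intro: inj_onI)
  have "g ` set xs \<subseteq> set xs'" using g by (meson image_subsetI set_zip_rightD)
  then have "g ` set xs = set xs'"
    using card_image[OF g_inj] distinct_card[OF distinct_xs] distinct_card[OF distinct_xs'] len
    by (intro card_subset_eq) auto
  with g_inj have g_bij: "bij_betw g (set xs) (set xs')" by (simp add: bij_betw_def)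
  define h where "h v = (if v \<in> set xs then g v else f v)" for v
  have hg: "h x = g x" if "x \<in> set xs" for x using that by (simp add: h_def)
  have hf: "h v = f v" if "v \<in> rest G xs" for v using that by (simp add: h_def rest_def)
  have "bij_betw h (set xs) (set xs')" "bij_betw h (rest G xs) (rest G' xs')"
    using g_bij f hg hf by (metis bij_betw_cong)+
  then have "bij_betw h (set xs \<union> rest G xs) (set xs' \<union> rest G' xs')"
    by (rule bij_betw_combine) (auto simp: rest_def)
  then have bij: "bij_betw h (pverts G) (pverts G')"
    using set_xs verts' by (simp add: rest_def Un_absorb1)
  have f_mem: "f v \<in> rest G' xs'" if "v \<in> rest G xs" for v
    using bij_betwE[OF f] that by blast
  have f_ctype: "ctype G' xs' (f v) = ctype G xs v" if "v \<in> rest G xs" for v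
    using f_type[OF that] by (simp add: dtype_def)
  have xv: "(x, v) \<in> parcs G \<longleftrightarrow> (g x, f v) \<in> parcs G'" if x: "x \<in> set xs" and v: "v \<in> rest G xs" for x v
  proof -
    obtain i where "i < length xs" "x = xs ! i" "g x = xs' ! i"
      using g[OF x] by (auto simp: in_set_zip)
    then show ?thesis
      using arg_cong[OF f_ctype[OF v], of "\<lambda>c. c ! i"] len by (simp add: ctype_def)
  qed
  have yv: "(y, v) \<in> parcs G \<longleftrightarrow> (f y, f v) \<in> parcs G'"
    if y: "y \<in> rest G xs" and v: "v \<in> rest G xs" and solo: "ctype G xs y \<in> solo G xs" for y v
  proof -
    let ?c = "ctype G xs y"
    have "(y, v) \<in> parcs G \<longleftrightarrow> ?c \<in> snd (dtype G xs v)"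
      unfolding dtype_def using solo y soloD[OF solo] by auto
    also have "\<dots> \<longleftrightarrow> ?c \<in> snd (dtype G' xs' (f v))" by (simp add: f_type[OF v])
    also have "\<dots> \<longleftrightarrow> (f y, f v) \<in> parcs G'"
      unfolding dtype_def using solo_eq solo f_mem[OF y] f_ctype[OF y] soloD[OF solo[folded solo_eq]] by auto
    finally show ?thesis .
  qed
  note sym = parcs_commute[OF graph] and sym' = parcs_commute[OF graph']
  have noloop: "(v, v) \<notin> parcs G" "(w, w) \<notin> parcs G'" for v w
    using graph graph' pair_loopfree_digraph.pair_no_loops
    unfolding pair_graph_def pair_digraph_def by fastforce+
  have uv: "(u, v) \<in> parcs G \<longleftrightarrow> (f u, f v) \<in> parcs G'" if u: "u \<in> rest G xs" and v: "v \<in> rest G xs" for u v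
  proof -
    consider "u = v" | "ctype G xs u \<in> solo G xs" | "ctype G xs v \<in> solo G xs"
      | "u \<noteq> v" "ctype G xs u \<notin> solo G xs" "ctype G xs v \<notin> solo G xs"
      by blast
    then show ?thesis
    proof cases
      case 1 then show ?thesis using noloop by simp
    next
      case 2 then show ?thesis using yv u v by blast
    next
      case 3 then show ?thesis using yv[OF v u] sym sym' by metis
    next
      case 4
      then have "f u \<noteq> f v" using u v bij_betw_imp_inj_on[OF f] by (auto dest: inj_onD)
      then show ?thesis using same_pattern u v 4 f_mem f_ctype by blast
    qed
  qed
  have "(u, v) \<in> parcs G \<longleftrightarrow> (h u, h v) \<in> parcs G'" if "u \<in> pverts G" "v \<in> pverts G" for u v
  proof -
    have "u \<in> set xs \<or> u \<in> rest G xs" "v \<in> set xs \<or> v \<in> rest G xs"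
      using that by (auto simp: rest_def)
    then show ?thesis
      using uv xv sym sym' hg hf partial_isoD(2)[OF piso g g] by metis
  qed
  with graph graph' bij show ?thesis by (rule digraph_isoI)
qed

end

section \<open>Choice of the list and conclusion\<close>

lemma isomorphic_if_survives:
  assumes "pair_graph G" "pair_graph G'" "card (pverts G) = n" "card (pverts G') = n"
    and adm: "admissible G xs"
    and "\<And>ys. admissible G' ys \<Longrightarrow> cost G xs \<le> cost G' ys"
    and surv: "survives G G' ((n + 5) div 2) {}"
  shows "digraph_iso (with_proj G) (with_proj G')"
proof -
  have fin: "finite (pverts G)"
    using assms(1) by (rule finite_pverts)
  \<comment> \<open>It follows that the list fits into the available rounds, so the subtraction
    below is exact.\<close>
  have "length xs < n - length xs"
    using adm card_ctypes_le[OF fin, of xs] card_rest[OF fin, of xs] assms(3)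
    by (simp add: admissible_def)
  then have "(n + 5) div 2 = ((n + 5) div 2 - length xs) + length xs" by simp
  then have "survives G G' ((n + 5) div 2 - length xs + length xs) {}" using surv by simp
  from survives_list[OF this] obtain xs' where xs': "length xs' = length xs" "set xs' \<subseteq> pverts G'"
    "survives G G' ((n + 5) div 2 - length xs) (set (zip xs xs'))"
    using adm by (auto simp: admissible_def)
  have "optimal_list G G' n ((n + 5) div 2) xs xs'"
    by (rule optimal_list.intro) (use assms xs' in auto)
  then show ?thesis by (rule optimal_list.isomorphic)
qed

text \<open>The empty list puts all vertices into one class and is therefore admissible; costs are
  well-ordered, so a least one is attained.\<close>

lemma optimal_admissible:
  assumes "finite (pverts G)" "pverts G \<noteq> {}"
  shows "\<exists>xs. admissible G xs \<and> (\<forall>ys. admissible G ys \<longrightarrow> cost G xs \<le> cost G ys)"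
proof -
  have "ctypes G [] = {[]}" using assms(2) by (auto simp: ctypes_def rest_def ctype_def)
  then have "admissible G []" by (simp add: admissible_def)
  then have "\<exists>k xs. admissible G xs \<and> cost G xs = k" by blast
  then obtain xs where xs: "admissible G xs"
    "cost G xs = (LEAST k. \<exists>xs. admissible G xs \<and> cost G xs = k)"
    using LeastI_ex[of "\<lambda>k. \<exists>xs. admissible G xs \<and> cost G xs = k"] by blast
  have "cost G xs \<le> cost G ys" if "admissible G ys" for ys
    unfolding xs(2) using that by (intro Least_le) blast
  with xs(1) show ?thesis by blast
qed

theorem theorem5p1:
  fixes G :: "'a pair_pre_digraph" and G' :: "'b pair_pre_digraph" and n :: nat
  assumes "pair_graph G" and "pair_graph G'"
    and "card (pverts G) = n" and "card (pverts G') = n"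
    and "\<not> digraph_iso (with_proj G) (with_proj G')"
  shows "ereal_of_enat (D0 G G') \<le> ereal ((real n + 5) / 2)"
proof -
  let ?K = "(n + 5) div 2"
  have fin: "finite (pverts G)" "finite (pverts G')"
    using assms(1,2) by (simp_all add: finite_pverts)
  have not_iso': "\<not> digraph_iso (with_proj G') (with_proj G)"
    using assms(2,5) digraph_iso_swap wf_digraph_wp_iff
    unfolding pair_graph_def pair_digraph_def pair_fin_digraph_def by blast
  \<comment> \<open>Empty graphs are isomorphic; from here on the empty list is admissible in both
    graphs.\<close>
  have "n \<noteq> 0"
  proof
    assume "n = 0"
    then have "pverts G = {}" "pverts G' = {}" using assms(3,4) fin by auto
    then have "digraph_iso (with_proj G) (with_proj G')"
      using digraph_isoI[OF assms(1,2), of undefined] by (simp add: bij_betw_def)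
    with assms(5) show False by contradiction
  qed
  then have "pverts G \<noteq> {}" "pverts G' \<noteq> {}" using assms(3,4) by auto
  with fin obtain xs xs' where
    xs: "admissible G xs" "\<And>ys. admissible G ys \<Longrightarrow> cost G xs \<le> cost G ys" and
    xs': "admissible G' xs'" "\<And>ys. admissible G' ys \<Longrightarrow> cost G' xs' \<le> cost G' ys"
    using optimal_admissible by metis
  \<comment> \<open>Spoiler plays in the graph whose best list is cheaper, so that list is optimal
    against the other graph too.\<close>
  have "\<not> survives G G' ?K {} \<or> \<not> survives G' G ?K {}"
  proof (cases "cost G xs \<le> cost G' xs'")
    case True
    then show ?thesis
      using isomorphic_if_survives[OF assms(1-4) xs(1)] xs'(2) assms(5) order_trans by metis
  next
    case False
    then have "cost G' xs' \<le> cost G xs" by simp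
    then show ?thesis
      using isomorphic_if_survives[OF assms(2,1,4,3) xs'(1)] xs(2) not_iso' order_trans by metis
  qed
  with fin have "D0 G G' \<le> enat ?K" by (rule D0_le_if_Spoiler_wins)
  then have "ereal_of_enat (D0 G G') \<le> ereal_of_enat (enat ?K)"
    by (simp only: ereal_of_enat_le_iff)
  moreover have "real (2 * ?K) \<le> real (n + 5)"
    unfolding of_nat_le_iff by simp
  then have "ereal_of_enat (enat ?K) \<le> ereal ((real n + 5) / 2)"
    by simp
  ultimately show ?thesis by (rule order_trans)
qed

end
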